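(* Let $A=\{a_n\}$ and $B=\{b_n\}$ be infinite sets of natural numbers, and assume that for some function $\vartheta:\mathbb{N}\to\mathbb{R}^+$ one has $$\limsup_{n\to\infty}\frac{a_n}{n\cdot\vartheta(n)}=l_1<\infty\quad\text{and}\quad\liminf_{n\to\infty}\frac{\vartheta(n\cdot b_n)}{n}=l_2<\infty,$$ where $l_1\cdot l_2<1/2$. Then there exists a sequence $\langle x_n\mid n\in\mathbb{N}\rangle$ of elements of $\Delta(B)$ such that $$\limsup_{n\to\infty}\left(\frac{\mathfrak{d}(A\cap(A+x_n))_{a_n}}{(\mathfrak{d}(A)_{a_n})^2}\right)\ \ge\ 1-2\,l_1l_2\ >\ 0.$$
   Context: $\mathbb{N}$ is the set of positive integers and $\mathbb{R}^+$ the set of positive reals. Writing $A=\{a_n\}$ means that $a_1<a_2<\ldots$ is the increasing enumeration of the infinite set $A\subseteq\mathbb{N}$; similarly for $B=\{b_n\}$. $A+x=\{a+x\mid a\in A\}$. $\Delta(B)=\{b-b'\mid b,b'\in B,\ b>b'\}$. For $C\subseteq\mathbb{N}$ and $m\in\mathbb{N}$, $\mathfrak{d}(C)_m=\frac{|C\cap[1,m]|}{m}$ is the relative density of $C$ on $[1,m]$. *)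

theory Defs
  imports Complex_Main "HOL-Library.Infinite_Set" "HOL-Library.Extended_Real"
begin

(* Sets of natural numbers in the sense of the source (positive integers only) are rendered
   as sets A :: nat set with 0 \<notin> A.

   The increasing enumeration a_1 < a_2 < ... of an infinite set starts at index 1,
   whereas enumerate starts at index 0.  The value at n = 0 is irrelevant. *)
definition nth_elem :: "nat set \<Rightarrow> nat \<Rightarrow> nat" where
  "nth_elem A n = enumerate A (n - 1)"

definition translate :: "nat set \<Rightarrow> nat \<Rightarrow> nat set" where
  "translate A x = {a + x | a. a \<in> A}"

definition Delta_set :: "nat set \<Rightarrow> nat set" where
  "Delta_set B = {b - b' | b b'. b \<in> B \<and> b' \<in> B \<and> b > b'}"

definition rel_density :: "nat set \<Rightarrow> nat \<Rightarrow> real" where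
  "rel_density C m = real (card (C \<inter> {1..m})) / real m"

end

theory Submission
  imports Defs "HOL-Analysis.Convex"
begin

text \<open>
  The idea is second-moment counting.  Let \<open>S\<close> be the first \<open>N\<close> elements of \<open>A\<close>, with largest
  element \<open>a\<close>, and let \<open>b\<close> be the \<open>m\<close>-th element of \<open>B\<close>.  The \<open>m\<close> translates of \<open>S\<close> by
  the first \<open>m\<close> elements of \<open>B\<close> all lie in the interval \<open>{1..a + b}\<close>, so by Cauchy--Schwarz
  (lemma \<open>power2_sum_card_le\<close>) their pairwise intersections, diagonal included, have total size at
  least \<open>(m N)\<^sup>2 / (a + b)\<close>.  The diagonal contributes only \<open>m N\<close>, and an off-diagonal
  intersection has the size of \<open>S \<inter> (S + x)\<close> for a difference \<open>x\<close> of two elements of \<open>B\<close>.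
  Hence some \<open>x\<close> in \<open>\<Delta>(B)\<close> has an intersection of at least average size; this is lemma
  \<open>translate_counting\<close>.

  The choice \<open>N = m b\<close> makes \<open>b\<close> negligible against \<open>a \<ge> N\<close>, and the normalised intersection
  is then at least \<open>1 - (a / N) / (m - 1)\<close> (lemma \<open>normalised_count_ge\<close>).  The two growth hypotheses
  speak about the two factors of
  \<open>a / (N m) = (a / (N \<theta>(N))) * (\<theta>(m b) / m)\<close>:
  the first is eventually below \<open>l1 + e\<close>, and the second is below \<open>l2 + e\<close> for
  infinitely many \<open>m\<close>.  So the normalised intersections have limit superior at least \<open>1 - l1 l2\<close>,
  along the indices \<open>N = m b\<close>.  To obtain one sequence for all indices, \<open>x n\<close> is chosen to maximise
  the intersection at index \<open>n\<close> over all of \<open>\<Delta>(B)\<close>.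
\<close>

section \<open>Counting intersections of translates\<close>

text \<open>
  Both sides count incidences: if \<open>d u\<close> is the number of sets containing \<open>u\<close>, the left side is
  the square of the sum of \<open>d\<close>, and the double sum on the right is the sum of \<open>d\<^sup>2\<close>.
\<close>

lemma power2_sum_card_le:
  fixes T :: "'i \<Rightarrow> 'u set"
  assumes U: "finite U" and T: "\<And>i. i \<in> I \<Longrightarrow> T i \<subseteq> U"
  shows "(\<Sum>i\<in>I. real (card (T i)))\<^sup>2 \<le> real (card U) * (\<Sum>i\<in>I. \<Sum>j\<in>I. real (card (T i \<inter> T j)))"
proof -
  define d where "d u = (\<Sum>i\<in>I. of_bool (u \<in> T i) :: real)" for u
  have card_eq: "real (card X) = (\<Sum>u\<in>U. of_bool (u \<in> X))" if "X \<subseteq> U" for X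
    using U that by (simp add: Int_absorb1)
  have "(\<Sum>i\<in>I. real (card (T i))) = (\<Sum>i\<in>I. \<Sum>u\<in>U. of_bool (u \<in> T i))"
    using T by (intro sum.cong card_eq) auto
  also have "\<dots> = (\<Sum>u\<in>U. d u)"
    unfolding d_def by (rule sum.swap)
  finally have first: "(\<Sum>i\<in>I. real (card (T i))) = (\<Sum>u\<in>U. d u)" .
  have "(\<Sum>u\<in>U. (d u)\<^sup>2) = (\<Sum>u\<in>U. \<Sum>i\<in>I. \<Sum>j\<in>I. of_bool (u \<in> T i \<inter> T j))"
    unfolding d_def power2_eq_square sum_product by (intro sum.cong) auto
  also have "\<dots> = (\<Sum>i\<in>I. \<Sum>u\<in>U. \<Sum>j\<in>I. of_bool (u \<in> T i \<inter> T j))"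
    by (rule sum.swap)
  also have "\<dots> = (\<Sum>i\<in>I. \<Sum>j\<in>I. \<Sum>u\<in>U. of_bool (u \<in> T i \<inter> T j))"
    by (intro sum.cong refl sum.swap)
  also have "\<dots> = (\<Sum>i\<in>I. \<Sum>j\<in>I. real (card (T i \<inter> T j)))"
    using T by (intro sum.cong refl card_eq[symmetric]) auto
  finally have second: "(\<Sum>u\<in>U. (d u)\<^sup>2) = (\<Sum>i\<in>I. \<Sum>j\<in>I. real (card (T i \<inter> T j)))" .
  show ?thesis
    using sum_squared_le_sum_of_squares[of d U] by (simp add: first second mult.commute)
qed

lemma translate_eq_image: "translate S x = (\<lambda>a. a + x) ` S"
  by (auto simp: translate_def)

lemma card_translate [simp]: "card (translate S x) = card S"
  unfolding translate_eq_image by (rule card_image) simp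

lemma card_translate_Int_translate:
  assumes "j \<le> i"
  shows "card (translate S i \<inter> translate S j) = card (S \<inter> translate S (i - j))"
proof -
  have "translate S i = translate (translate S (i - j)) j"
    using assms unfolding translate_eq_image image_image by (intro image_cong) auto
  then have "translate S i \<inter> translate S j = translate (S \<inter> translate S (i - j)) j"
    by (auto simp: translate_def)
  then show ?thesis
    by simp
qed

lemma Delta_set_mono: "F \<subseteq> B \<Longrightarrow> Delta_set F \<subseteq> Delta_set B"
  unfolding Delta_set_def by blast

text \<open>
  Pigeonhole in contrapositive form: a bound \<open>c\<close> valid for every difference also bounds the average
  over the off-diagonal pairs, while each diagonal pair contributes exactly \<open>card S\<close>.
\<close>

lemma translate_counting:
  assumes S: "S \<subseteq> {1..M}" and F: "F \<subseteq> {..K}"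
    and c: "\<And>x. x \<in> Delta_set F \<Longrightarrow> real (card (S \<inter> translate S x)) \<le> c"
  shows "(real (card F) * real (card S))\<^sup>2
           \<le> real (M + K) * (real (card F) * real (card S) + real (card F) * (real (card F) - 1) * c)"
proof -
  have fin: "finite F"
    using F finite_subset by blast
  have off: "real (card (translate S i \<inter> translate S j)) \<le> c" if "i \<in> F" "j \<in> F" "i \<noteq> j" for i j
  proof (cases "j < i")
    case True
    then have "i - j \<in> Delta_set F"
      using that by (auto simp: Delta_set_def)
    then show ?thesis
      using True c by (simp add: card_translate_Int_translate)
  next
    case False
    with that have "i < j"
      by simp
    with that have "j - i \<in> Delta_set F"
      by (auto simp: Delta_set_def)
    then show ?thesis
      using False c by (subst Int_commute) (simp add: card_translate_Int_translate)
  qed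
  have row: "(\<Sum>j\<in>F. real (card (translate S i \<inter> translate S j)))
               \<le> real (card S) + (real (card F) - 1) * c" if i: "i \<in> F" for i
  proof -
    have "(\<Sum>j\<in>F. real (card (translate S i \<inter> translate S j)))
            = real (card S) + (\<Sum>j\<in>F - {i}. real (card (translate S i \<inter> translate S j)))"
      using fin i by (subst sum.remove[of _ i]) auto
    also have "\<dots> \<le> real (card S) + (\<Sum>j\<in>F - {i}. c)"
      using off i by (intro add_left_mono sum_mono) auto
    also have "\<dots> = real (card S) + (real (card F) - 1) * c"
    proof -
      have "card F \<ge> 1"
        using fin i by (metis card_0_eq empty_iff less_one not_le)
      then show ?thesis
        using fin i by (simp add: of_nat_diff)
    qed
    finally show ?thesis .
  qed
  have "translate S i \<subseteq> {1..M + K}" if "i \<in> F" for i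
    using S F that by (fastforce simp: translate_def subset_iff)
  then have "(\<Sum>i\<in>F. real (card (translate S i)))\<^sup>2
      \<le> real (card {1..M + K})
        * (\<Sum>i\<in>F. \<Sum>j\<in>F. real (card (translate S i \<inter> translate S j)))"
    by (intro power2_sum_card_le) auto
  also have "\<dots> \<le> real (card {1..M + K}) * (\<Sum>i\<in>F. real (card S) + (real (card F) - 1) * c)"
    by (intro mult_left_mono sum_mono row) auto
  finally show ?thesis
    by (simp add: algebra_simps)
qed

section \<open>The enumeration of an infinite set\<close>

lemma Int_upto_nth_elem:
  assumes "infinite A" and "0 \<notin> A" and "n \<ge> 1"
  shows "A \<inter> {1..nth_elem A n} = enumerate A ` {..<n}"
proof (intro equalityI subsetI)
  fix y assume y: "y \<in> A \<inter> {1..nth_elem A n}"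
  then obtain k where k: "enumerate A k = y"
    using assms enumerate_Ex by blast
  with y have "enumerate A k \<le> enumerate A (n - 1)"
    by (simp add: nth_elem_def)
  then have "k \<le> n - 1"
    using enumerate_mono_le_iff[OF assms(1)] by blast
  with k show "y \<in> enumerate A ` {..<n}"
    using assms by auto
next
  fix y assume "y \<in> enumerate A ` {..<n}"
  then obtain k where k: "k < n" "y = enumerate A k"
    by auto
  then have "y \<in> A"
    using assms by (simp add: enumerate_in_set)
  moreover have "y \<le> nth_elem A n"
    using assms k by (simp add: nth_elem_def)
  ultimately show "y \<in> A \<inter> {1..nth_elem A n}"
    using assms by (auto simp: Suc_le_eq intro: Nat.gr0I)
qed

lemma card_Int_upto_nth_elem:
  assumes "infinite A" and "0 \<notin> A" and "n \<ge> 1"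
  shows "card (A \<inter> {1..nth_elem A n}) = n"
proof -
  have "inj_on (enumerate A) {..<n}"
    using inj_enumerate[OF assms(1)] inj_on_subset by blast
  then show ?thesis
    by (simp only: Int_upto_nth_elem[OF assms] card_image card_lessThan)
qed

lemma nth_elem_ge:
  assumes "infinite A" and "0 \<notin> A" and "n \<ge> 1"
  shows "n \<le> nth_elem A n"
  using card_Int_upto_nth_elem[OF assms] card_mono[of "{1..nth_elem A n}" "A \<inter> {1..nth_elem A n}"]
  by simp

text \<open>
  Truncation at \<open>M\<close> may be done before or after translating, because an element of \<open>A + x\<close> that is at
  most \<open>M\<close> comes from an element of \<open>A\<close> that is at most \<open>M\<close>.
\<close>

lemma Int_translate_cutoff:
  assumes "0 \<notin> A"
  shows "(A \<inter> {1..M}) \<inter> translate (A \<inter> {1..M}) x = (A \<inter> translate A x) \<inter> {1..M}"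
  using assms by (auto simp: translate_def Suc_le_eq intro!: exI Nat.gr0I)

lemma density_ratio_eq:
  assumes "infinite A" and "0 \<notin> A" and "n \<ge> 1"
  shows "rel_density C (nth_elem A n) / (rel_density A (nth_elem A n))\<^sup>2
           = real (card (C \<inter> {1..nth_elem A n})) * real (nth_elem A n) / (real n)\<^sup>2"
  using nth_elem_ge[OF assms] assms
  by (simp add: rel_density_def card_Int_upto_nth_elem[simplified] power2_eq_square field_simps)

section \<open>The lower bound at a single index\<close>

text \<open>
  Since \<open>m * b \<le> a\<close>, the ratio \<open>a / (a + b)\<close> is at least \<open>m / (m + 1)\<close>.  Its loss is
  outweighed by the gain \<open>m / (m - 1)\<close> from discarding the diagonal, so the main term is at
  least \<open>1\<close>.
\<close>

lemma normalised_count_ge: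
  fixes m b a c :: real
  assumes m: "m > 1" and b: "b > 0" and a: "m * b \<le> a"
    and count: "(m * (m * b))\<^sup>2 \<le> (a + b) * (m * (m * b) + m * (m - 1) * c)"
  shows "1 - (a / (m * b)) / (m - 1) \<le> c * a / (m * b)\<^sup>2"
proof -
  define N where "N = m * b"
  have N: "N > 0"
    using m b by (simp add: N_def)
  then have a0: "a > 0"
    using a by (simp add: N_def)
  have "m * (m * N\<^sup>2) \<le> m * ((a + b) * (N + (m - 1) * c))"
    using count unfolding N_def[symmetric] by (simp add: power2_eq_square algebra_simps)
  then have "m * N\<^sup>2 \<le> (a + b) * (N + (m - 1) * c)"
    using m by simp
  then have "m * N\<^sup>2 / (a + b) \<le> N + (m - 1) * c"
    using a0 b by (simp add: field_simps)
  then have "m * N\<^sup>2 / (a + b) * a \<le> (N + (m - 1) * c) * a"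
    using a0 by (intro mult_right_mono) auto
  moreover have "(m - 1) * N\<^sup>2 \<le> m * N\<^sup>2 / (a + b) * a"
  proof -
    have "(m - 1) * (a + b) \<le> m * a"
    proof -
      have "(m - 1) * b \<le> m * b" using b by simp
      then show ?thesis using a by (simp add: algebra_simps)
    qed
    then have "(m - 1) * (a + b) * N\<^sup>2 \<le> m * a * N\<^sup>2"
      by (intro mult_right_mono) auto
    then show ?thesis
      using a0 b by (simp add: field_simps)
  qed
  ultimately have "(m - 1) * N\<^sup>2 - N * a \<le> (m - 1) * (c * a)"
    by (simp add: algebra_simps)
  then have "((m - 1) * N\<^sup>2 - N * a) / ((m - 1) * N\<^sup>2) \<le> (m - 1) * (c * a) / ((m - 1) * N\<^sup>2)"
    using m N by (intro divide_right_mono) auto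
  moreover have "((m - 1) * N\<^sup>2 - N * a) / ((m - 1) * N\<^sup>2) = 1 - (a / N) / (m - 1)"
    using m N by (simp add: diff_divide_distrib power2_eq_square)
  moreover have "(m - 1) * (c * a) / ((m - 1) * N\<^sup>2) = c * a / N\<^sup>2"
    using m by simp
  ultimately show ?thesis
    by (simp add: N_def)
qed

lemma density_ratio_ge:
  fixes c :: real
  assumes A: "infinite A" "0 \<notin> A" and B: "infinite B" "0 \<notin> B" and m: "m \<ge> 2"
    and N: "N = m * nth_elem B m"
    and c: "\<And>x. x \<in> Delta_set B \<Longrightarrow> real (card ((A \<inter> translate A x) \<inter> {1..nth_elem A N})) \<le> c"
  shows "1 - (real (nth_elem A N) / real N) / (real m - 1)
           \<le> c * real (nth_elem A N) / (real N)\<^sup>2"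
proof -
  define S where "S = A \<inter> {1..nth_elem A N}"
  define F where "F = B \<inter> {1..nth_elem B m}"
  have b: "nth_elem B m \<ge> 1"
    using nth_elem_ge[OF B, of m] m by simp
  have N1: "N \<ge> 1"
    using m b N by simp
  have cardS: "card S = N" and cardF: "card F = m"
    using A B N1 m by (simp_all add: S_def F_def card_Int_upto_nth_elem del: One_nat_def)
  have "Delta_set F \<subseteq> Delta_set B"
    by (intro Delta_set_mono) (simp add: F_def)
  then have "real (card (S \<inter> translate S x)) \<le> c" if "x \<in> Delta_set F" for x
    using c[of x] that Int_translate_cutoff[OF A(2), of "nth_elem A N" x] by (auto simp: S_def)
  then have "(real (card F) * real (card S))\<^sup>2 \<le> real (nth_elem A N + nth_elem B m)
      * (real (card F) * real (card S) + real (card F) * (real (card F) - 1) * c)"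
    by (intro translate_counting) (auto simp: S_def F_def)
  then have count: "(real m * (real m * real (nth_elem B m)))\<^sup>2
      \<le> (real (nth_elem A N) + real (nth_elem B m))
        * (real m * (real m * real (nth_elem B m)) + real m * (real m - 1) * c)"
    by (simp add: cardS cardF N)
  have "real m * real (nth_elem B m) \<le> real (nth_elem A N)"
    using nth_elem_ge[OF A N1] by (metis N of_nat_le_iff of_nat_mult)
  from normalised_count_ge[OF _ _ this count] show ?thesis
    using m b by (simp add: N)
qed

section \<open>Passing to the limit\<close>

lemma frequently_less_of_liminf_less:
  fixes f :: "nat \<Rightarrow> ereal"
  assumes "liminf f < C"
  shows "\<exists>\<^sub>F n in sequentially. f n < C"
proof (rule ccontr)
  assume "\<not> ?thesis"
  then have "\<forall>\<^sub>F n in sequentially. C \<le> f n"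
    by (simp add: not_frequently not_less)
  then have "C \<le> liminf f"
    by (rule Liminf_bounded)
  with assms show False
    by simp
qed

text \<open>
  The application takes \<open>f n\<close> to be the size of the largest intersection at index \<open>n\<close>.  The number \<open>e\<close> is the error allowed in each of the two hypotheses, and
  the factor \<open>1 + e\<close> absorbs \<open>m / (m - 1)\<close>.
\<close>

lemma limsup_density_ratio_ge:
  fixes \<theta> :: "nat \<Rightarrow> real" and f :: "nat \<Rightarrow> nat"
  assumes A: "infinite A" "0 \<notin> A" and B: "infinite B" "0 \<notin> B"
    and \<theta>: "\<And>n. n \<ge> 1 \<Longrightarrow> \<theta> n > 0"
    and l1: "limsup (\<lambda>n. ereal (real (nth_elem A n) / (real n * \<theta> n))) = ereal l1"
    and l2: "liminf (\<lambda>n. ereal (\<theta> (n * nth_elem B n) / real n)) = ereal l2"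
    and f: "\<And>n x. x \<in> Delta_set B \<Longrightarrow> card ((A \<inter> translate A x) \<inter> {1..nth_elem A n}) \<le> f n"
    and e: "e > 0"
  shows "ereal (1 - (1 + e) * (l1 + e) * (l2 + e))
           \<le> limsup (\<lambda>n. ereal (real (f n) * real (nth_elem A n) / (real n)\<^sup>2))" (is "?C \<le> limsup ?g")
proof (rule ccontr)
  assume "\<not> ?thesis"
  then have "\<forall>\<^sub>F n in sequentially. ?g n < ?C"
    by (intro Limsup_lessD) simp
  moreover have "\<forall>\<^sub>F n in sequentially.
      ereal (real (nth_elem A n) / (real n * \<theta> n)) < ereal (l1 + e)"
    using e by (intro Limsup_lessD) (simp add: l1)
  ultimately have "\<forall>\<^sub>F n in sequentially. ?g n < ?C \<and>
      ereal (real (nth_elem A n) / (real n * \<theta> n)) < ereal (l1 + e)"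
    by (rule eventually_conj)
  then obtain n0 where n0: "\<And>n. n \<ge> n0 \<Longrightarrow> ?g n < ?C \<and>
      ereal (real (nth_elem A n) / (real n * \<theta> n)) < ereal (l1 + e)"
    by (auto simp: eventually_sequentially)
  have "\<exists>\<^sub>F m in sequentially. ereal (\<theta> (m * nth_elem B m) / real m) < ereal (l2 + e)"
    using e by (intro frequently_less_of_liminf_less) (simp add: l2)
  \<comment> \<open>For \<open>m \<ge> 1 + 1/e\<close> one has \<open>m / (m - 1) \<le> 1 + e\<close>.\<close>
  then obtain m where m: "m \<ge> max n0 (max 2 (nat \<lceil>1 + 1 / e\<rceil>))"
    and \<theta>m: "\<theta> (m * nth_elem B m) / real m < l2 + e"
    unfolding frequently_sequentially by (metis ereal_less_eq(3) not_le)
  define N where "N = m * nth_elem B m"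
  have "nth_elem B m \<ge> 1"
    using nth_elem_ge[OF B, of m] m by simp
  then have "m \<le> N"
    by (simp add: N_def)
  then have "N \<ge> n0" and N1: "N \<ge> 1"
    using m by auto
  with n0 have g: "real (f N) * real (nth_elem A N) / (real N)\<^sup>2 < 1 - (1 + e) * (l1 + e) * (l2 + e)"
    and aN: "real (nth_elem A N) / (real N * \<theta> N) < l1 + e"
    by auto
  have \<theta>N: "\<theta> N > 0"
    using \<theta> N1 by simp
  have m_ge: "1 + 1 / e \<le> real m" and m2: "m \<ge> 2"
    using m by linarith+
  have factor: "real m / (real m - 1) \<le> 1 + e"
    using m_ge m2 e by (simp add: field_simps)
  have "(real (nth_elem A N) / real N) / (real m - 1)
      = real m / (real m - 1) * (real (nth_elem A N) / (real N * \<theta> N)) * (\<theta> N / real m)"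
    using m2 N1 \<theta>N by (simp add: field_simps)
  also have "\<dots> \<le> (1 + e) * (l1 + e) * (l2 + e)"
  proof (intro mult_mono)
    show "\<theta> N / real m \<le> l2 + e"
      using \<theta>m by (simp add: N_def)
    have "0 \<le> l1 + e"
      by (rule order_trans[OF _ less_imp_le[OF aN]]) (use \<theta>N in simp)
    then show "0 \<le> (1 + e) * (l1 + e)"
      using e by simp
  qed (use factor aN \<theta>N e in auto)
  finally have upper: "(real (nth_elem A N) / real N) / (real m - 1) \<le> (1 + e) * (l1 + e) * (l2 + e)" .
  have "1 - (real (nth_elem A N) / real N) / (real m - 1)
      \<le> real (f N) * real (nth_elem A N) / (real N)\<^sup>2"
    using f by (intro density_ratio_ge[OF A B m2 N_def]) simp
  with upper g show False
    by linarith
qed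

text \<open>
  The best shift \<open>x n\<close> at each index exists because the intersections there lie in one finite
  interval.
  Letting \<open>e\<close> tend to \<open>0\<close> gives the bound \<open>1 - l1 * l2\<close>, which implies the claim since \<open>l1\<close>
  and \<open>l2\<close> are limits of nonnegative quantities.
\<close>

theorem corollary4p3:
  fixes A B :: "nat set" and \<theta> :: "nat \<Rightarrow> real" and l1 l2 :: real
  assumes "infinite A" and "0 \<notin> A"
    and "infinite B" and "0 \<notin> B"
    and "\<And>n. n \<ge> 1 \<Longrightarrow> \<theta> n > 0"
    and "limsup (\<lambda>n. ereal (real (nth_elem A n) / (real n * \<theta> n))) = ereal l1"
    and "liminf (\<lambda>n. ereal (\<theta> (n * nth_elem B n) / real n)) = ereal l2"
    and "l1 * l2 < 1 / 2"
  shows "\<exists>x :: nat \<Rightarrow> nat. (\<forall>n\<ge>1. x n \<in> Delta_set B) \<and>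
           limsup (\<lambda>n. ereal (rel_density (A \<inter> translate A (x n)) (nth_elem A n)
                              / (rel_density A (nth_elem A n))\<^sup>2)) \<ge> ereal (1 - 2 * l1 * l2) \<and>
           1 - 2 * l1 * l2 > 0"
proof -
  define F where "F n y = card ((A \<inter> translate A y) \<inter> {1..nth_elem A n})" for n y
  have "enumerate B 1 - enumerate B 0 \<in> Delta_set B"
    using assms(3) by (auto simp: Delta_set_def enumerate_in_set intro!: exI)
  moreover have "F n y \<le> nth_elem A n" for n y
    using card_mono[of "{1..nth_elem A n}" "(A \<inter> translate A y) \<inter> {1..nth_elem A n}"]
    by (simp add: F_def)
  ultimately have "\<exists>x. x \<in> Delta_set B \<and> (\<forall>y. y \<in> Delta_set B \<longrightarrow> F n y \<le> F n x)" for n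
    by (intro Lattices_Big.ex_has_greatest_nat[where b = "Suc (nth_elem A n)"])
       (auto simp: less_Suc_eq_le)
  then obtain x where x: "\<And>n. x n \<in> Delta_set B"
    and max: "\<And>n y. y \<in> Delta_set B \<Longrightarrow> F n y \<le> F n (x n)"
    by metis
  let ?L = "limsup (\<lambda>n. ereal (rel_density (A \<inter> translate A (x n)) (nth_elem A n)
                              / (rel_density A (nth_elem A n))\<^sup>2))"
  have L: "?L = limsup (\<lambda>n. ereal (real (F n (x n)) * real (nth_elem A n) / (real n)\<^sup>2))"
    by (intro Limsup_eq eventually_sequentiallyI[of 1])
       (simp only: F_def density_ratio_eq[OF assms(1,2)])
  have approx: "ereal (1 - (1 + e) * (l1 + e) * (l2 + e)) \<le> ?L" if "e > 0" for e
    unfolding L F_def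
    by (intro limsup_density_ratio_ge[where \<theta> = \<theta> and B = B] that assms(1-7))
       (assumption, rule max[unfolded F_def])
  have "((\<lambda>e. 1 - (1 + e) * (l1 + e) * (l2 + e)) \<longlongrightarrow> 1 - (1 + 0) * (l1 + 0) * (l2 + 0)) (at_right 0)"
    by (intro tendsto_intros)
  then have "((\<lambda>e. ereal (1 - (1 + e) * (l1 + e) * (l2 + e))) \<longlongrightarrow> ereal (1 - l1 * l2)) (at_right 0)"
    by simp
  then have bound: "ereal (1 - l1 * l2) \<le> ?L"
    by (rule tendsto_upperbound) (auto intro!: eventually_at_rightI[of 0 1] approx)
  have "0 \<le> ereal l1"
    unfolding assms(6)[symmetric]
    by (intro le_Limsup eventually_sequentiallyI[of 1]) (auto simp: assms(5) less_imp_le)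
  moreover have "0 \<le> ereal l2"
    unfolding assms(7)[symmetric]
  proof (intro Liminf_bounded eventually_sequentiallyI[of 1])
    fix n :: nat assume n: "1 \<le> n"
    then have "1 \<le> n * nth_elem B n"
      using nth_elem_ge[OF assms(3,4) n] by simp
    then show "0 \<le> ereal (\<theta> (n * nth_elem B n) / real n)"
      using assms(5) by (simp add: less_imp_le)
  qed
  ultimately have "0 \<le> l1 * l2"
    by simp
  then have "ereal (1 - 2 * l1 * l2) \<le> ereal (1 - l1 * l2)"
    by simp
  with bound have "ereal (1 - 2 * l1 * l2) \<le> ?L"
    by (rule order_trans[rotated])
  with x assms(8) show ?thesis
    by (intro exI[of _ x]) simp
qed

end
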